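(* Let $a>1$. Place $n$ sensors on $[0,\infty)$ at the first $n$ arrival times $X_1<\dots<X_n$ of a homogeneous Poisson process on $[0,\infty)$ with rate $n$. Then any sensor displacement algorithm which solves the $\left(\frac1n,\frac1n\right)$-interference problem requires expected $a$-total movement of at least $\Omega\!\left(n^{1-\frac a2}\right)$.
   Context: A sensor displacement algorithm assigns to each sensor (as a function of the initial positions) a final position in $[0,\infty)$. For $0<s\le v$, it solves the $(s,v)$-interference problem if, in the final configuration, every two consecutive sensors (consecutive in the order of final positions) are at distance at least $s$ and at most $v$. If the $i$-th sensor is displaced by a distance $|m(i)|$, the $a$-total movement is $\sum_{i=1}^n|m(i)|^a$. Asymptotics are as $n\to\infty$ with $a$ fixed. *)

theory Defs
  imports "HOL-Probability.Probability"
begin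

text \<open>Number of arrivals in the time interval \<open>(s, t]\<close>, where \<open>T i\<close> is the time of
  arrival number \<open>i + 1\<close> (so \<open>T 0\<close> is the first arrival).\<close>

definition arrivals_between :: "(nat \<Rightarrow> 'w \<Rightarrow> real) \<Rightarrow> real \<Rightarrow> real \<Rightarrow> 'w \<Rightarrow> nat" where
  "arrivals_between T s t \<omega> = card {i. s < T i \<omega> \<and> T i \<omega> \<le> t}"

text \<open>\<open>T\<close> is the sequence of arrival times of a homogeneous Poisson process on
  \<open>[0, \<infinity>)\<close>: the arrivals are positive, strictly increasing and locally finite, and the
  counting process has independent Poisson increments. Local finiteness is needed because
  \<open>card\<close> is 0 on infinite sets.\<close>

definition poisson_arrival_times :: "'w measure \<Rightarrow> real \<Rightarrow> (nat \<Rightarrow> 'w \<Rightarrow> real) \<Rightarrow> bool" where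
  "poisson_arrival_times M rate T \<longleftrightarrow>
     prob_space M \<and>
     (\<forall>i. T i \<in> borel_measurable M) \<and>
     (AE \<omega> in M. 0 < T 0 \<omega> \<and> strict_mono (\<lambda>i. T i \<omega>) \<and> (\<forall>t. finite {i. T i \<omega> \<le> t})) \<and>
     (\<forall>(\<tau> :: nat \<Rightarrow> real) k. 0 \<le> \<tau> 0 \<and> strict_mono_on {..k} \<tau> \<longrightarrow>
        prob_space.indep_vars M (\<lambda>_. count_space UNIV)
          (\<lambda>j. arrivals_between T (\<tau> j) (\<tau> (Suc j))) {..<k}) \<and>
     (\<forall>s t. 0 \<le> s \<and> s < t \<longrightarrow>
        distr M (count_space UNIV) (arrivals_between T s t)
          = measure_pmf (poisson_pmf (rate * (t - s))))"

definition initial_positions :: "nat \<Rightarrow> real list set" where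
  "initial_positions n = {xs. length xs = n \<and> set xs \<subseteq> {0..} \<and> sorted_wrt (<) xs}"

text \<open>An algorithm maps the list of initial positions to the list of final positions;
  entry \<open>i\<close> of either list belongs to the same sensor, and the final positions need not
  preserve the initial order.\<close>

definition displacement_algorithm :: "nat \<Rightarrow> (real list \<Rightarrow> real list) \<Rightarrow> bool" where
  "displacement_algorithm n A \<longleftrightarrow>
     (\<forall>xs \<in> initial_positions n. length (A xs) = n \<and> set (A xs) \<subseteq> {0..})"

text \<open>Sorting makes consecutive list entries consecutive sensors; sensors sharing a
  position count as consecutive sensors at distance 0.\<close>

definition interference_config :: "real \<Rightarrow> real \<Rightarrow> real list \<Rightarrow> bool" where
  "interference_config s v ys \<longleftrightarrow>
     (\<forall>i. Suc i < length ys \<longrightarrow>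
        s \<le> sort ys ! Suc i - sort ys ! i \<and> sort ys ! Suc i - sort ys ! i \<le> v)"

definition solves_interference :: "nat \<Rightarrow> real \<Rightarrow> real \<Rightarrow> (real list \<Rightarrow> real list) \<Rightarrow> bool" where
  "solves_interference n s v A \<longleftrightarrow>
     (\<forall>xs \<in> initial_positions n. interference_config s v (A xs))"

definition total_movement :: "real \<Rightarrow> real list \<Rightarrow> real list \<Rightarrow> real" where
  "total_movement a xs ys = (\<Sum>i<length xs. \<bar>ys ! i - xs ! i\<bar> powr a)"

text \<open>The expectation is a nonnegative integral, so it may be infinite. For an algorithm with
  non-measurable movement it is the lower integral, hence no measurability of \<open>A\<close> is required.\<close>

definition expected_movement ::
  "'w measure \<Rightarrow> real \<Rightarrow> nat \<Rightarrow> (nat \<Rightarrow> 'w \<Rightarrow> real) \<Rightarrow> (real list \<Rightarrow> real list) \<Rightarrow> ennreal" where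
  "expected_movement M a n X A =
     (\<integral>\<^sup>+\<omega>. ennreal (let xs = map (\<lambda>i. X i \<omega>) [0..<n] in total_movement a xs (A xs)) \<partial>M)"

end

theory Submission
  imports Defs
begin

text \<open>By convexity \<open>t \<mapsto> t powr a\<close> lies above its tangent at \<open>r = c / sqrt n\<close>, so it suffices that
  the expected \<open>1\<close>-total movement is at least \<open>n * r = c * sqrt n\<close>. The final positions are
  \<open>b + j / n\<close> for \<open>j < n\<close>, with an offset \<open>b\<close> that may depend on everything. Put \<open>h = n div 4\<close> and
  consider the windows \<open>(k / n, (k + h) / n]\<close> for \<open>2 h \<le> k < 3 h\<close>. If \<open>b \<le> 2 h / n\<close>, each of them
  contains \<open>h\<close> final positions, whatever \<open>b\<close> is. A sensor moved by \<open>m\<close> leaves or enters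
  about \<open>n m\<close> windows, so the movement dominates the average deficit \<open>(h - N)\<^sup>+\<close> of the Poisson
  numbers \<open>N\<close> of initial positions in the windows, whose mean is of order \<open>sqrt h\<close>. Deficits, unlike
  surpluses, only grow when the arrivals after the first \<open>n\<close> are dropped. If \<open>b > 2 h / n\<close>, all
  sensors that start in \<open>[0, h / n]\<close> move by at least \<open>h / n\<close>, and Chebyshev's inequality controls
  the event that there are few of them.\<close>


section \<open>Convexity and lower deficits of the Poisson distribution\<close>

text \<open>The bound is affine in \<open>m\<close>, so it passes through the sum over sensors and
  through expectations.\<close>

lemma powr_ge_tangent:
  fixes a m r :: real
  assumes "1 \<le> a" "0 \<le> m" "0 < r"
  shows "r powr a + a * r powr (a - 1) * (m - r) \<le> m powr a"
\<comment> \<open>Convexity is applied on the open half-line; at \<open>m = 0\<close> the claim is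
  (1 - a) r^a \<le> 0, since \<open>0 powr a\<close> is 0.\<close>
proof (cases "m = 0")
  case True
  have "r powr a = r powr (a - 1) * r"
    using assms by (simp add: powr_diff)
  moreover have "r powr (a - 1) * r * 1 \<le> r powr (a - 1) * r * a"
    using assms by (intro mult_left_mono) auto
  ultimately show ?thesis
    using True by (simp add: algebra_simps)
next
  case False
  have "a * r powr (a - 1) * (m - r) \<le> m powr a - r powr a"
  proof (rule convex_on_imp_above_tangent[where A = "{0<..}"])
    show "convex_on {0<..} (\<lambda>x. x powr a)"
      using assms by (intro powr_convex)
    show "((\<lambda>x. x powr a) has_real_derivative a * r powr (a - 1)) (at r within {0<..})"
      using assms by (auto intro!: derivative_eq_intros simp: powr_diff)
  qed (use assms False in \<open>auto simp: interior_open\<close>)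
  then show ?thesis by simp
qed

text \<open>Stirling's upper bound with e in place of sqrt(2 pi): the ratio of the two sides is 1 at
  k = 1 and does not increase afterwards.\<close>

lemma fact_le_sqrt_exp:
  assumes "1 \<le> k"
  shows "fact k * exp (real k) \<le> exp 1 * sqrt (real k) * real k ^ k"
  using assms
proof (induction k rule: dec_induct)
  case (step k)
  define x where "x = real k"
  have x: "1 \<le> x" using step by (simp add: x_def)
  \<comment> \<open>Midpoint bound for the integral of the convex function 1/t over
    [x, x + 1].\<close>
  have "2 / (2 * x + 1) \<le> ln (x + 1) - ln x"
    using ln_inverse_approx_ge[of x "x + 1"] x by simp
  then have "1 \<le> (x + 1/2) * (ln (x + 1) - ln x)"
    using x by (simp add: field_simps)
  then have "exp (1 + (x + 1/2) * ln x) \<le> exp ((x + 1/2) * ln (x + 1))"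
    by (simp add: algebra_simps)
  then have "exp 1 * x powr (x + 1/2) \<le> (x + 1) powr (x + 1/2)"
    using x by (simp add: powr_def exp_add)
  then have *: "exp 1 * (sqrt x * x ^ k) \<le> sqrt (x + 1) * (x + 1) ^ k"
    using x by (simp add: powr_add powr_half_sqrt powr_realpow x_def mult_ac)
  have "fact (Suc k) * exp (real (Suc k)) = (x + 1) * exp 1 * (fact k * exp x)"
    by (simp add: x_def exp_add algebra_simps)
  also have "\<dots> \<le> (x + 1) * exp 1 * (exp 1 * sqrt x * x ^ k)"
    using step.IH x by (intro mult_left_mono) (auto simp: x_def)
  also have "\<dots> = ((x + 1) * exp 1) * (exp 1 * (sqrt x * x ^ k))"
    by simp
  also have "\<dots> \<le> ((x + 1) * exp 1) * (sqrt (x + 1) * (x + 1) ^ k)"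
    using * x by (intro mult_left_mono) auto
  finally show ?case
    by (simp add: x_def algebra_simps)
qed simp

lemma pmf_poisson_Suc:
  assumes "0 < l"
  shows "real (Suc j) * pmf (poisson_pmf l) (Suc j) = l * pmf (poisson_pmf l) j"
  using assms by (simp add: divide_simps)

text \<open>By the recursion above, (l - j) p_j = (j + 1) p_{j+1} - j p_j, so the sum
  telescopes.\<close>

lemma sum_poisson_deficit:
  assumes "0 < l"
  shows "(\<Sum>j<m. (l - real j) * pmf (poisson_pmf l) j) = real m * pmf (poisson_pmf l) m"
  using pmf_poisson_Suc[OF assms]
  by (induction m) (simp_all add: algebra_simps del: pmf_poisson)

text \<open>Summation by parts in the same telescoping identity; the boundary term vanishes at m =
  l.\<close>

lemma sum_poisson_deficit_sq:
  assumes "0 < l"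
  shows "(\<Sum>j<m. (l - real j)\<^sup>2 * pmf (poisson_pmf l) j)
         = (l - real m) * (real m * pmf (poisson_pmf l) m) + l * (\<Sum>j<m. pmf (poisson_pmf l) j)"
proof (induction m)
  case (Suc m)
  then show ?case
    unfolding pmf_poisson_Suc[OF assms] sum.lessThan_Suc
    by (simp add: algebra_simps power2_eq_square del: pmf_poisson)
qed simp

lemma expectation_poisson_deficit:
  assumes "1 \<le> h"
  shows "sqrt (real h) / exp 1 \<le>
    measure_pmf.expectation (poisson_pmf (real h)) (\<lambda>j. max 0 (real h - real j))"
proof -
  let ?p = "pmf (poisson_pmf (real h))"
  have "measure_pmf.expectation (poisson_pmf (real h)) (\<lambda>j. max 0 (real h - real j))
      = (\<Sum>j<h. max 0 (real h - real j) * ?p j)"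
    by (intro integral_measure_pmf_real) (auto simp: max_def split: if_splits)
  also have "\<dots> = (\<Sum>j<h. (real h - real j) * ?p j)"
    by (intro sum.cong) auto
  also have "\<dots> = real h * ?p h"
    using assms by (intro sum_poisson_deficit) auto
  also have "\<dots> = real h * (real h ^ h / (fact h * exp (real h)))"
    using assms by (simp add: exp_minus divide_inverse)
  also have "\<dots> \<ge> real h * (real h ^ h / (exp 1 * sqrt (real h) * real h ^ h))"
    using assms fact_le_sqrt_exp[OF assms] by (intro mult_left_mono divide_left_mono) auto
  also have "real h * (real h ^ h / (exp 1 * sqrt (real h) * real h ^ h))
      = (real h / sqrt (real h)) / exp 1"
    using assms by (simp add: field_simps)
  also have "real h / sqrt (real h) = sqrt (real h)"
    using assms by (simp add: real_div_sqrt)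
  finally show ?thesis .
qed

lemma expectation_poisson_deficit_sq:
  assumes "1 \<le> h"
  shows "measure_pmf.expectation (poisson_pmf (real h)) (\<lambda>j. (max 0 (real h - real j))\<^sup>2) \<le> real h"
proof -
  let ?p = "pmf (poisson_pmf (real h))"
  have "measure_pmf.expectation (poisson_pmf (real h)) (\<lambda>j. (max 0 (real h - real j))\<^sup>2)
      = (\<Sum>j<h. (max 0 (real h - real j))\<^sup>2 * ?p j)"
    by (intro integral_measure_pmf_real) (auto simp: max_def split: if_splits)
  also have "\<dots> = (\<Sum>j<h. (real h - real j)\<^sup>2 * ?p j)"
    by (intro sum.cong) auto
  also have "\<dots> = real h * (\<Sum>j<h. ?p j)"
    using sum_poisson_deficit_sq[of "real h" h] assms by (simp del: pmf_poisson)
  also have "(\<Sum>j<h. ?p j) = measure (poisson_pmf (real h)) {..<h}"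
    by (simp add: measure_measure_pmf_finite del: pmf_poisson)
  also have "real h * \<dots> \<le> real h * 1"
    by (intro mult_left_mono measure_pmf.prob_le_1) simp
  finally show ?thesis by simp
qed

section \<open>Windows crossed by a displacement\<close>

lemma card_nat_interval_le:
  fixes p q :: real
  assumes "p \<le> q"
  shows "real (card {k::nat. p \<le> real k \<and> real k < q}) \<le> q - p + 1"
proof -
  have "card {k::nat. p \<le> real k \<and> real k < q} \<le> card {\<lceil>p\<rceil>..<\<lceil>q\<rceil>}"
    by (rule card_inj_on_le[of int]) (auto simp: ceiling_le_iff less_ceiling_iff)
  also have "\<dots> = nat (\<lceil>q\<rceil> - \<lceil>p\<rceil>)" by simp
  finally have "real (card {k::nat. p \<le> real k \<and> real k < q}) \<le> real (nat (\<lceil>q\<rceil> - \<lceil>p\<rceil>))"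
    by linarith
  also have "\<dots> = of_int (\<lceil>q\<rceil> - \<lceil>p\<rceil>)"
    using ceiling_mono[OF assms] by simp
  also have "\<dots> \<le> q - p + 1" by linarith
  finally show ?thesis .
qed

text \<open>If u \<le> v, the left end of such a window lies in [u, v); otherwise its right end lies
  in [v, u). Either range has length |u - v|, whatever h is.\<close>

lemma card_windows_separating_le:
  fixes u v h :: real
  shows "real (card {k::nat. k \<in> G \<and>
           v \<in> {real k<..real k + h} \<and> u \<notin> {real k<..real k + h}}) \<le> \<bar>u - v\<bar> + 1"
    (is "real (card ?S) \<le> _")
proof -
  have fin: "finite {k::nat. p \<le> real k \<and> real k < q}" for p q :: real
    by (rule finite_subset[of _ "{..nat \<lceil>q\<rceil>}"]) (auto, linarith)
  show ?thesis
  proof (cases "u \<le> v")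
    case True
    have "card ?S \<le> card {k::nat. u \<le> real k \<and> real k < v}"
      by (rule card_mono[OF fin]) (use True in auto)
    then show ?thesis using card_nat_interval_le[OF True] True by linarith
  next
    case False
    have "card ?S \<le> card {k::nat. v - h \<le> real k \<and> real k < u - h}"
      by (rule card_mono[OF fin]) (use False in auto)
    then show ?thesis using card_nat_interval_le[of "v - h" "u - h"] False by linarith
  qed
qed

text \<open>Double counting of pairs of a window and a sensor that enters it: a deficit must be
  filled by entering sensors, and each sensor enters few windows. The term \<open>real n\<close>
  collects the rounding error 1 per sensor. Positions are in units of 1/n.\<close>

lemma sum_window_deficits_le:
  fixes u v :: "nat \<Rightarrow> real" and h :: nat
  assumes G: "finite G"
    and v: "\<And>k. k \<in> G \<Longrightarrow> h \<le> card {i. i < n \<and> v i \<in> {real k<..real k + real h}}"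
  shows "(\<Sum>k\<in>G. max 0 (real h - real (card {i. i < n \<and> u i \<in> {real k<..real k + real h}})))
         \<le> (\<Sum>i<n. \<bar>u i - v i\<bar>) + real n"
proof -
  let ?W = "\<lambda>k::nat. {real k<..real k + real h}"
  let ?R = "\<lambda>k i. v i \<in> ?W k \<and> u i \<notin> ?W k"
  have "max 0 (real h - real (card {i. i < n \<and> u i \<in> ?W k})) \<le> real (card {i. i < n \<and> ?R k i})"
    if "k \<in> G" for k
  proof -
    have "card {i. i < n \<and> v i \<in> ?W k} \<le> card ({i. i < n \<and> ?R k i} \<union> {i. i < n \<and> u i \<in> ?W k})"
      by (intro card_mono) auto
    also have "\<dots> \<le> card {i. i < n \<and> ?R k i} + card {i. i < n \<and> u i \<in> ?W k}"
      by (rule card_Un_le)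
    finally show ?thesis using v[OF that] by linarith
  qed
  then have "(\<Sum>k\<in>G. max 0 (real h - real (card {i. i < n \<and> u i \<in> ?W k})))
      \<le> (\<Sum>k\<in>G. real (card {i. i < n \<and> ?R k i}))"
    by (intro sum_mono)
  also have "\<dots> = (\<Sum>k\<in>G. \<Sum>i<n. of_bool (?R k i))"
    by (intro sum.cong refl) (simp add: Int_def)
  also have "\<dots> = (\<Sum>i<n. \<Sum>k\<in>G. of_bool (?R k i))"
    by (rule sum.swap)
  also have "\<dots> = (\<Sum>i<n. real (card {k. k \<in> G \<and> ?R k i}))"
    using G by (intro sum.cong refl) (simp add: Int_def)
  also have "\<dots> \<le> (\<Sum>i<n. \<bar>u i - v i\<bar> + 1)"
    by (intro sum_mono card_windows_separating_le)
  also have "\<dots> = (\<Sum>i<n. \<bar>u i - v i\<bar>) + real n"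
    by (simp add: sum.distrib)
  finally show ?thesis .
qed

text \<open>Allows final positions to be counted in sorted order although sensors may overtake each
  other.\<close>

lemma card_nth_sort:
  "card {i. i < length ys \<and> P (ys ! i)} = card {i. i < length ys \<and> P (sort ys ! i)}"
  using length_filter_conv_card[of P ys] length_filter_conv_card[of P "sort ys"]
  by (simp add: filter_sort)

lemma interference_config_sort_nth:
  assumes "interference_config s s ys" "j < length ys"
  shows "sort ys ! j = sort ys ! 0 + real j * s"
  using assms(2)
proof (induction j)
  case (Suc j)
  then have "sort ys ! Suc j - sort ys ! j = s"
    using assms(1) by (auto simp: interference_config_def intro: antisym)
  then show ?case using Suc by (simp add: algebra_simps)
qed simp

text \<open>In units of 1/n the final positions have spacing 1, and a half-open window of length h
  meets such a lattice in h points. The bounds on \<open>k\<close> keep these points between the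
  first and the last sensor.\<close>

lemma interference_config_window_card:
  fixes b :: real
  assumes conf: "interference_config (1 / real n) (1 / real n) ys" and len: "length ys = n"
    and b: "0 \<le> sort ys ! 0" "real n * sort ys ! 0 \<le> real k" and k: "k + h < n"
  shows "h \<le> card {i. i < n \<and> real n * ys ! i \<in> {real k<..real k + real h}}"
proof -
  let ?b = "sort ys ! 0"
  \<comment> \<open>Sorted index of the last lattice point not to the right of \<open>k\<close>; the
    next \<open>h\<close> points fill the window.\<close>
  define f where "f = nat \<lfloor>real k - real n * ?b\<rfloor>"
  have n: "0 < n" using k by simp
  have f: "real f \<le> real k - real n * ?b" "real k - real n * ?b < real f + 1"
    using b by (auto simp: f_def)
  have "real f \<le> real k" using f(1) mult_nonneg_nonneg[of "real n" ?b] b(1) by linarith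
  then have fk: "f \<le> k" by simp
  have "real n * sort ys ! j \<in> {real k<..real k + real h} \<and> j < n" if "j \<in> {Suc f..f + h}" for j
  proof -
    have j: "j < n" using that fk k by simp
    have "real n * sort ys ! j = real n * ?b + real j"
      using interference_config_sort_nth[OF conf, of j] j len n by (simp add: distrib_left)
    moreover have "real f + 1 \<le> real j" "real j \<le> real f + real h" using that by auto
    ultimately show ?thesis using f j by auto
  qed
  then have "card {Suc f..f + h} \<le> card {i. i < n \<and> real n * sort ys ! i \<in> {real k<..real k + real h}}"
    by (intro card_mono) auto
  then show ?thesis
    using card_nth_sort[of ys "\<lambda>y. real n * y \<in> {real k<..real k + real h}"] len by simp
qed


section \<open>Pointwise comparison of deficits and movement\<close>

text \<open>Passes from the infinite process to the n sensors: if an arrival beyond the first n is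
  counted, then by monotonicity all n sensors lie below t.\<close>

lemma card_initial_segment_ge:
  fixes x :: "nat \<Rightarrow> real"
  assumes "mono x" "finite {i. s < x i \<and> x i \<le> t}" "s < x 0"
  shows "min n (card {i. s < x i \<and> x i \<le> t}) \<le> card {i. i < n \<and> x i \<le> t}"
proof (cases "{i. s < x i \<and> x i \<le> t} \<subseteq> {..<n}")
  case True
  then have "card {i. s < x i \<and> x i \<le> t} \<le> card {i. i < n \<and> x i \<le> t}"
    by (intro card_mono) auto
  then show ?thesis by simp
next
  case False
  then obtain m where "m \<notin> {..<n}" and m: "x m \<le> t" by blast
  then have m: "n \<le> m" "x m \<le> t" by auto
  have "x i \<le> t" if "i < n" for i
    using monoD[OF assms(1), of i m] that m by linarith
  then have "{i. i < n \<and> x i \<le> t} = {..<n}" by auto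
  then show ?thesis by simp
qed

text \<open>The term \<open>4 * (max 0 (h - N 0))\<^sup>2\<close> makes the left-hand side nonpositive if \<open>N 0 < h / 2\<close>,
  the case in which nothing is known when \<open>b > 2 h / n\<close>. It replaces \<open>h\<^sup>2\<close> times the indicator of
  that event, so that the application of Chebyshev's inequality becomes pointwise.\<close>

lemma window_deficits_le_movement:
  fixes x :: "nat \<Rightarrow> real" and n :: nat
  defines "h \<equiv> n div 4"
  defines "N \<equiv> \<lambda>k::nat. card {i. real k / real n < x i \<and> x i \<le> real (k + h) / real n}"
  assumes n: "4 \<le> n"
    and x: "0 < x 0" "strict_mono x" "\<And>t. finite {i. x i \<le> t}"
    and ys: "length ys = n" "set ys \<subseteq> {0..}"
    and conf: "interference_config (1 / real n) (1 / real n) ys"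
  shows "(\<Sum>k=2*h..<3*h. max 0 (real h - real (N k))) - 4 * (max 0 (real h - real (N 0)))\<^sup>2
         \<le> 2 * real n * ((\<Sum>i<n. \<bar>ys ! i - x i\<bar>) + 1)"
proof -
  define b where "b = sort ys ! 0"
  define S where "S = (\<Sum>i<n. \<bar>ys ! i - x i\<bar>)"
  define D where "D = (\<Sum>k=2*h..<3*h. max 0 (real h - real (N k)))"
  have S0: "0 \<le> S" unfolding S_def by (intro sum_nonneg) auto
  have n0: "0 < n" and h0: "0 < h" and hn: "4 * h \<le> n" using n by (auto simp: h_def)
  have fin: "finite {i. s < x i \<and> x i \<le> t}" for s t
    by (rule finite_subset[OF _ x(3)[of t]]) auto
  have b_in: "b \<in> set ys"
    using ys n0 nth_mem[of 0 "sort ys"] by (simp add: b_def)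
  then have b0: "0 \<le> b" using ys by auto
  have b_le: "b \<le> ys ! i" if "i < n" for i
  proof -
    have "ys ! i \<in> set (sort ys)" using that ys by simp
    then obtain j where "j < length (sort ys)" "ys ! i = sort ys ! j"
      by (metis in_set_conv_nth)
    then show ?thesis by (auto simp: b_def intro!: sorted_nth_mono)
  qed
  show ?thesis
  proof (cases "real n * b \<le> real (2 * h)")
    case True
    have *: "h \<le> card {i. i < n \<and> real n * ys ! i \<in> {real k<..real k + real h}}"
      if "k \<in> {2*h..<3*h}" for k
    proof (rule interference_config_window_card[OF conf ys(1)])
      show "real n * sort ys ! 0 \<le> real k" using True that unfolding b_def[symmetric] by auto
      \<comment> \<open>This is where four blocks of length \<open>h\<close> must fit into
        \<open>n\<close>: k + h < 4h \<le> n.\<close>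
      show "k + h < n" using that hn by auto
    qed (use b0 b_def in auto)
    have "D \<le> (\<Sum>k=2*h..<3*h. max 0 (real h -
        real (card {i. i < n \<and> real n * x i \<in> {real k<..real k + real h}})))"
      unfolding D_def
    proof (intro sum_mono)
      fix k
      have "card {i. i < n \<and> real n * x i \<in> {real k<..real k + real h}} \<le> N k"
        unfolding N_def by (intro card_mono fin) (use n0 in \<open>auto simp: field_simps\<close>)
      then show "max 0 (real h - real (N k)) \<le> max 0 (real h -
          real (card {i. i < n \<and> real n * x i \<in> {real k<..real k + real h}}))"
        by simp
    qed
    also have "\<dots> \<le> (\<Sum>i<n. \<bar>real n * x i - real n * ys ! i\<bar>) + real n"
      by (rule sum_window_deficits_le) (use * in auto)
    also have "(\<Sum>i<n. \<bar>real n * x i - real n * ys ! i\<bar>) = real n * S"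
      unfolding S_def sum_distrib_left
      by (intro sum.cong refl)
        (simp add: abs_minus_commute abs_mult flip: right_diff_distrib)
    finally have "D \<le> real n * (S + 1)" by (simp add: algebra_simps)
    also have "\<dots> \<le> 2 * real n * (S + 1)"
      using S0 by (simp add: mult_right_mono)
    finally show ?thesis unfolding D_def S_def by (smt (verit) zero_le_power2)
  next
    case False
    have "D \<le> (\<Sum>k=2*h..<3*h. real h)"
      unfolding D_def by (intro sum_mono) simp
    then have D: "D \<le> (real h)\<^sup>2" by (simp add: power2_eq_square)
    show ?thesis
    proof (cases "2 * N 0 < h")
      case True
      then have "(real h / 2)\<^sup>2 \<le> (max 0 (real h - real (N 0)))\<^sup>2"
        by (intro power_mono) auto
      then have "D - 4 * (max 0 (real h - real (N 0)))\<^sup>2 \<le> 0"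
        using D by (simp add: power_divide)
      also have "0 \<le> 2 * real n * (S + 1)" using S0 by simp
      finally show ?thesis unfolding D_def S_def .
    next
      case False
      let ?I = "{i. i < n \<and> x i \<le> real h / real n}"
      have "min n (N 0) \<le> card ?I"
        using card_initial_segment_ge[OF strict_mono_mono[OF x(2)] fin, of 0] x(1)
        by (simp add: N_def)
      then have I: "real h / 2 \<le> real (card ?I)"
        using False hn by linarith
      have "real (card ?I) * (real h / real n) = (\<Sum>i\<in>?I. real h / real n)" by simp
      also have "\<dots> \<le> (\<Sum>i\<in>?I. \<bar>ys ! i - x i\<bar>)"
      proof (intro sum_mono)
        fix i assume i: "i \<in> ?I"
        have "2 * (real h / real n) \<le> b"
          using \<open>\<not> real n * b \<le> real (2 * h)\<close> n0 by (simp add: field_simps)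
        then show "real h / real n \<le> \<bar>ys ! i - x i\<bar>"
          using i b_le[of i] by auto
      qed
      also have "\<dots> \<le> S"
        unfolding S_def by (intro sum_mono2) auto
      finally have "real (card ?I) * real h \<le> real n * S"
        using n0 by (simp add: field_simps)
      moreover have "real h / 2 * real h \<le> real (card ?I) * real h"
        using I by (intro mult_right_mono) auto
      \<comment> \<open>At least h/2 sensors move by h/n each, so S \<ge> h^2 / (2n); the factor 2
        in the conclusion comes from here.\<close>
      ultimately have "D \<le> 2 * (real n * S)"
        using D by (simp add: power2_eq_square)
      also have "\<dots> \<le> 2 * real n * (S + 1)" by (simp add: algebra_simps)
      finally show ?thesis unfolding D_def S_def by (smt (verit) zero_le_power2)
    qed
  qed
qed

section \<open>Expectations over the Poisson process\<close>

text \<open>Independence of random variables includes their measurability; a grid with the single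
  step from s to t extracts it.\<close>

lemma poisson_arrivals_measurable:
  assumes "poisson_arrival_times M l X" "0 \<le> s" "s < t"
  shows "arrivals_between X s t \<in> M \<rightarrow>\<^sub>M count_space UNIV"
proof -
  interpret prob_space M using assms by (simp add: poisson_arrival_times_def)
  define \<tau> where "\<tau> = (\<lambda>j::nat. s + real j * (t - s))"
  have "strict_mono_on {..1} \<tau>"
    using assms by (auto simp: strict_mono_on_def \<tau>_def)
  moreover have "0 \<le> \<tau> 0" using assms by (simp add: \<tau>_def)
  ultimately have "indep_vars (\<lambda>_. count_space UNIV)
      (\<lambda>j. arrivals_between X (\<tau> j) (\<tau> (Suc j))) {..<1}"
    using assms(1) unfolding poisson_arrival_times_def by blast
  then have "arrivals_between X (\<tau> 0) (\<tau> (Suc 0)) \<in> M \<rightarrow>\<^sub>M count_space UNIV"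
    by (auto simp: indep_vars_def)
  then show ?thesis by (simp add: \<tau>_def)
qed

lemma poisson_arrivals_expectation:
  fixes f :: "nat \<Rightarrow> real"
  assumes "poisson_arrival_times M l X" "0 \<le> s" "s < t"
  shows "(\<integral>\<omega>. f (arrivals_between X s t \<omega>) \<partial>M)
         = measure_pmf.expectation (poisson_pmf (l * (t - s))) f"
proof -
  have "distr M (count_space UNIV) (arrivals_between X s t)
      = measure_pmf (poisson_pmf (l * (t - s)))"
    using assms unfolding poisson_arrival_times_def by blast
  then show ?thesis
    using integral_distr[OF poisson_arrivals_measurable[OF assms], of f] by simp
qed

text \<open>The main term h^(3/2) / (2 e n) has order sqrt n, while the second-moment term 4h / (2n)
  and the rounding term 1 stay bounded.\<close>

lemma deficit_bound_eventually:
  "\<forall>\<^sub>F n in sequentially. sqrt (real n) / 200 \<le>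
     (real (n div 4) * (sqrt (real (n div 4)) / exp 1) - 4 * real (n div 4)) / (2 * real n) - 1"
  \<comment> \<open>4000000 = 2000^2, and s \<ge> 2000 suffices for s/162 - 3/2 \<ge> s/200.\<close>
  using eventually_ge_at_top[of 4000000]
proof eventually_elim
  case (elim n)
  define h where "h = n div 4"
  define s where "s = sqrt (real n)"
  \<comment> \<open>A weak lower bound for \<open>n div 4\<close>, chosen because 9 has an integer
    square root.\<close>
  have h: "real n / 9 \<le> real h" "4 * real h \<le> real n"
    using elim unfolding h_def by linarith+
  have s: "2000 \<le> s" "s * s = real n"
    using elim real_le_rsqrt[of 2000 "real n"] by (auto simp: s_def)
  have e: "exp 1 \<le> (3::real)" by (rule exp_le)
  have "sqrt (real n / 9) \<le> sqrt (real h)" using h by (intro real_sqrt_le_mono)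
  moreover have "sqrt 9 = (3::real)" by (rule real_sqrt_unique) auto
  ultimately have "s / 3 \<le> sqrt (real h)"
    by (simp add: s_def real_sqrt_divide)
  then have "s / 3 / 3 \<le> sqrt (real h) / exp 1"
    using e s by (intro frac_le) auto
  then have "real n / 9 * (s / 9) \<le> real h * (sqrt (real h) / exp 1)"
    using h s by (intro mult_mono) auto
  then have "(real n / 9 * (s / 9) - real n) / (2 * real n) \<le>
      (real h * (sqrt (real h) / exp 1) - 4 * real h) / (2 * real n)"
    using h by (intro divide_right_mono diff_mono) auto
  moreover have "(real n / 9 * (s / 9) - real n) / (2 * real n) = s / 162 - 1 / 2"
    using elim by (simp add: field_simps)
  ultimately show ?case
    using s unfolding h_def[symmetric] s_def[symmetric] by linarith
qed

theorem theorem5: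
  fixes a :: real
  assumes "a > 1"
  shows "\<exists>c>0. \<forall>\<^sub>F n in sequentially.
           \<forall>(M :: 'w measure) X A.
             poisson_arrival_times M (real n) X \<longrightarrow>
             displacement_algorithm n A \<longrightarrow>
             solves_interference n (1 / real n) (1 / real n) A \<longrightarrow>
             expected_movement M a n X A \<ge> ennreal (c * real n powr (1 - a / 2))"
proof (intro exI conjI)
  show "0 < (1 / 200 :: real) powr a" by simp
  show "\<forall>\<^sub>F n in sequentially.
           \<forall>(M :: 'w measure) X A.
             poisson_arrival_times M (real n) X \<longrightarrow>
             displacement_algorithm n A \<longrightarrow>
             solves_interference n (1 / real n) (1 / real n) A \<longrightarrow>
             expected_movement M a n X A \<ge> ennreal ((1 / 200) powr a * real n powr (1 - a / 2))"
    using deficit_bound_eventually eventually_ge_at_top[of 4]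
  proof eventually_elim
    case (elim n)
    show ?case
    proof (intro allI impI)
      fix M :: "'w measure" and X A
      assume X: "poisson_arrival_times M (real n) X"
        and A: "displacement_algorithm n A"
        and solves: "solves_interference n (1 / real n) (1 / real n) A"
      interpret prob_space M using X by (simp add: poisson_arrival_times_def)
      define h where "h = n div 4"
      \<comment> \<open>Point of tangency: a lower bound for the mean displacement per sensor. Then
        n r^a is exactly the claimed bound.\<close>
      define r where "r = 1 / 200 / sqrt (real n)"
      define N where "N = (\<lambda>k::nat. arrivals_between X (real k / real n) (real (k + h) / real n))"
      define D where "D = (\<lambda>k \<omega>. max 0 (real h - real (N k \<omega>)))"
      \<comment> \<open>\<open>L\<close> will bound the 1-total movement from below and
        \<open>Z\<close>, by the tangent, the a-total movement. Both depend only on Poisson counts,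
        so they are measurable even if the movement is not.\<close>
      define L where "L = (\<lambda>\<omega>. ((\<Sum>k=2*h..<3*h. D k \<omega>) - 4 * (D 0 \<omega>)\<^sup>2) / (2 * real n) - 1)"
      define Z where "Z = (\<lambda>\<omega>. real n * r powr a + a * r powr (a - 1) * (L \<omega> - real n * r))"
      have n0: "0 < n" and h0: "1 \<le> h" and r0: "0 < r"
        using elim(2) by (auto simp: h_def r_def)
      have N_int: "real k / real n < real (k + h) / real n" for k
        using n0 h0 by (simp add: divide_strict_right_mono)
      have N_meas [measurable]: "N k \<in> M \<rightarrow>\<^sub>M count_space UNIV" for k
        unfolding N_def by (rule poisson_arrivals_measurable[OF X _ N_int]) simp
      have N_exp: "(\<integral>\<omega>. f (N k \<omega>) \<partial>M) = measure_pmf.expectation (poisson_pmf (real h)) f"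
        for k and f :: "nat \<Rightarrow> real"
      proof -
        have "real n * (real (k + h) / real n - real k / real n) = real h"
          using n0 by (simp add: field_simps)
        then show ?thesis
          using poisson_arrivals_expectation[OF X _ N_int[of k], of f] by (simp add: N_def)
      qed
      have D_int [simp]: "integrable M (D k)" for k
        by (rule integrable_const_bound[of _ "real h"]) (auto simp: D_def)
      have D2_int [simp]: "integrable M (\<lambda>\<omega>. (D k \<omega>)\<^sup>2)" for k
        by (rule integrable_const_bound[of _ "(real h)\<^sup>2"])
          (auto simp: D_def intro!: power_mono)
      have ED: "sqrt (real h) / exp 1 \<le> expectation (D k)" for k
        using expectation_poisson_deficit[OF h0] N_exp[of "\<lambda>j. max 0 (real h - real j)" k]
        by (simp add: D_def)
      have ED2: "expectation (\<lambda>\<omega>. (D k \<omega>)\<^sup>2) \<le> real h" for k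
        using expectation_poisson_deficit_sq[OF h0]
          N_exp[of "\<lambda>j. (max 0 (real h - real j))\<^sup>2" k]
        by (simp add: D_def)
      have L_int [simp]: "integrable M L" unfolding L_def by simp
      have "real n * r = sqrt (real n) / 200"
        using n0 by (simp add: r_def real_div_sqrt)
      also have "\<dots> \<le> (real h * (sqrt (real h) / exp 1) - 4 * real h) / (2 * real n) - 1"
        using elim(1) by (simp add: h_def)
      also have "\<dots> \<le> ((\<Sum>k=2*h..<3*h. expectation (D k)) - 4 * expectation (\<lambda>\<omega>. (D 0 \<omega>)\<^sup>2))
          / (2 * real n) - 1"
      proof -
        have "(\<Sum>k=2*h..<3*h. sqrt (real h) / exp 1) \<le> (\<Sum>k=2*h..<3*h. expectation (D k))"
          by (intro sum_mono ED)
        then show ?thesis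
          using ED2[of 0] by (intro diff_right_mono divide_right_mono) auto
      qed
      also have "\<dots> = expectation L"
        unfolding L_def by (simp add: prob_space)
      finally have EL: "real n * r \<le> expectation L" .
      have Z_int: "integrable M Z" unfolding Z_def by simp
      have "(1 / 200) powr a * real n powr (1 - a / 2) = real n * r powr a"
        using n0 by (simp add: r_def powr_divide powr_mult powr_diff powr_powr flip: powr_half_sqrt)
      also have "\<dots> \<le> real n * r powr a + a * r powr (a - 1) * (expectation L - real n * r)"
        using EL assms by simp
      also have "\<dots> = expectation Z"
        unfolding Z_def by (simp add: prob_space)
      \<comment> \<open>\<open>Z\<close> can be negative; its positive part has a nonnegative
        integral equal to its expectation and still lies below the nonnegative movement.\<close>
      also have "\<dots> \<le> expectation (\<lambda>\<omega>. max 0 (Z \<omega>))"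
        using Z_int by (intro integral_mono) auto
      finally have "ennreal ((1 / 200) powr a * real n powr (1 - a / 2))
          \<le> ennreal (expectation (\<lambda>\<omega>. max 0 (Z \<omega>)))"
        by (rule ennreal_leI)
      also have "\<dots> = (\<integral>\<^sup>+\<omega>. ennreal (max 0 (Z \<omega>)) \<partial>M)"
        using Z_int by (intro nn_integral_eq_integral[symmetric]) auto
      also have "\<dots> \<le> expected_movement M a n X A"
        unfolding expected_movement_def
      proof (rule nn_integral_mono_AE)
        have "AE \<omega> in M. 0 < X 0 \<omega> \<and> strict_mono (\<lambda>i. X i \<omega>) \<and> (\<forall>t. finite {i. X i \<omega> \<le> t})"
          using X by (simp add: poisson_arrival_times_def)
        then show "AE \<omega> in M. ennreal (max 0 (Z \<omega>))
            \<le> ennreal (let xs = map (\<lambda>i. X i \<omega>) [0..<n] in total_movement a xs (A xs))"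
        proof eventually_elim
          case (elim \<omega>)
          define xs where "xs = map (\<lambda>i. X i \<omega>) [0..<n]"
          define m where "m = (\<lambda>i. \<bar>A xs ! i - X i \<omega>\<bar>)"
          have "0 \<le> X i \<omega>" for i
            using elim strict_mono_less_eq[of "\<lambda>i. X i \<omega>" 0 i] by auto
          then have xs: "xs \<in> initial_positions n"
            using elim strict_monoD[of "\<lambda>i. X i \<omega>"]
            by (auto simp: initial_positions_def xs_def sorted_wrt_iff_nth_less)
          have "length (A xs) = n" "set (A xs) \<subseteq> {0..}"
            and "interference_config (1 / real n) (1 / real n) (A xs)"
            using A solves xs by (auto simp: displacement_algorithm_def solves_interference_def)
          then have "(\<Sum>k=2*h..<3*h. D k \<omega>) - 4 * (D 0 \<omega>)\<^sup>2 \<le> 2 * real n * ((\<Sum>i<n. m i) + 1)"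
            unfolding D_def N_def m_def arrivals_between_def h_def
            using \<open>4 \<le> n\<close> elim by (intro window_deficits_le_movement) blast+
          then have "L \<omega> \<le> (\<Sum>i<n. m i)"
            using n0 by (simp add: L_def field_simps)
          then have "Z \<omega> \<le> real n * r powr a + a * r powr (a - 1) * ((\<Sum>i<n. m i) - real n * r)"
            unfolding Z_def using assms by (intro add_left_mono mult_left_mono) auto
          also have "\<dots> = (\<Sum>i<n. r powr a + a * r powr (a - 1) * (m i - r))"
            by (simp add: sum.distrib sum_subtractf flip: sum_distrib_left)
          also have "\<dots> \<le> (\<Sum>i<n. m i powr a)"
            using assms r0 by (intro sum_mono powr_ge_tangent) (auto simp: m_def)
          also have "\<dots> = total_movement a xs (A xs)"
            by (simp add: total_movement_def m_def xs_def)
          finally have "max 0 (Z \<omega>) \<le> total_movement a xs (A xs)"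
            by (simp add: total_movement_def sum_nonneg)
          then show ?case
            unfolding xs_def Let_def by (rule ennreal_leI)
        qed
      qed
      finally show "ennreal ((1 / 200) powr a * real n powr (1 - a / 2)) \<le> expected_movement M a n X A" .
    qed
  qed
qed

end
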